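(* Let $n$ be a positive integer. Then the equation $$x^4+y^4+z^4-2x^2y^2-2y^2z^2-2z^2x^2=n$$ has an integer solution $(x,y,z)$ if, and only if, there exist positive integers $a,b,c,d$ which satisfy the three conditions $$a+d=b+c,\qquad abcd=n,\qquad a\equiv b\equiv c\equiv d \pmod 2$$ (i.e. all four are even or all four are odd). *)

theory Defs
  imports Main "HOL-Number_Theory.Cong"
begin

end

theory Submission
  imports Defs
begin

text \<open>
  The quartic is, up to sign, Heron's expression for sixteen times the squared area of a
  triangle, and so it splits into four linear factors (lemma \<open>heron_factorization\<close>):
  \<^term>\<open>a = x + y + z\<close>, \<^term>\<open>b = x + y - z\<close>, \<^term>\<open>c = x - y + z\<close> and
  \<^term>\<open>d = x - y - z\<close>. These satisfy \<^term>\<open>a + d = b + c\<close> (both sides are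
  \<^term>\<open>2 * x\<close>) and have the same parity. Conversely, four integers with these two properties
  arise from \<^term>\<open>x = (a + d) div 2\<close>, \<^term>\<open>y = (a - c) div 2\<close> and
  \<^term>\<open>z = (a - b) div 2\<close>.

  The remaining point is positivity of the factors. The quartic is symmetric and even in each
  variable, so one may assume \<^term>\<open>x \<ge> y \<and> y \<ge> z \<and> z \<ge> 0\<close>. Then the first three
  factors are nonnegative; as the product is positive, they are positive and so is the fourth.
\<close>

lemma heron_factorization:
  fixes x y z :: "'a :: comm_ring_1"
  shows "x^4 + y^4 + z^4 - 2 * x^2 * y^2 - 2 * y^2 * z^2 - 2 * z^2 * x^2
    = (x + y + z) * (x + y - z) * (x - y + z) * (x - y - z)"
  by (simp add: algebra_simps power2_eq_square power4_eq_xxxx)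

text \<open>
  Each sign change or transposition of the variables permutes the four factors up to an even
  number of sign changes, so a solution can be moved into the chamber of sorted nonnegative triples.
\<close>

lemma heron_product_sorted_nonneg:
  fixes x y z :: int
  obtains u v w where "u \<ge> v" "v \<ge> w" "w \<ge> 0"
    "(u + v + w) * (u + v - w) * (u - v + w) * (u - v - w)
      = (x + y + z) * (x + y - z) * (x - y + z) * (x - y - z)"
proof -
  define H :: "int \<Rightarrow> int \<Rightarrow> int \<Rightarrow> int"
    where "H u v w = (u + v + w) * (u + v - w) * (u - v + w) * (u - v - w)" for u v w
  have H_swap12: "H u v w = H v u w" and H_swap23: "H u v w = H u w v" for u v w
    unfolding H_def by algebra+
  have H_abs: "H \<bar>x\<bar> \<bar>y\<bar> \<bar>z\<bar> = H x y z"
    unfolding H_def heron_factorization[symmetric] by (simp add: power_even_abs)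
  have sorted: "\<exists>u v w. u \<ge> v \<and> v \<ge> w \<and> w \<ge> 0 \<and> H u v w = H p q r"
    if "p \<ge> 0" "q \<ge> 0" "r \<ge> 0" for p q r
    using that H_swap12 H_swap23 by (metis linear)
  show thesis
    using sorted[of "\<bar>x\<bar>" "\<bar>y\<bar>" "\<bar>z\<bar>"] that H_abs unfolding H_def by auto
qed

lemma heron_factors_pos:
  fixes u v w :: int
  assumes "u \<ge> v" "v \<ge> w" "w \<ge> 0"
    and pos: "(u + v + w) * (u + v - w) * (u - v + w) * (u - v - w) > 0"
  shows "u + v + w > 0" "u + v - w > 0" "u - v + w > 0" "u - v - w > 0"
proof -
  have "u + v + w \<noteq> 0" "u + v - w \<noteq> 0" "u - v + w \<noteq> 0"
    using pos by auto
  then show "u + v + w > 0" "u + v - w > 0" "u - v + w > 0"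
    using assms(1-3) by linarith+
  then have "(u + v + w) * (u + v - w) * (u - v + w) > 0"
    by simp
  then show "u - v - w > 0"
    using pos zero_less_mult_pos by blast
qed

theorem theorem3:
  fixes n :: int
  assumes "n > 0"
  shows "(\<exists>x y z :: int.
            x^4 + y^4 + z^4 - 2 * x^2 * y^2 - 2 * y^2 * z^2 - 2 * z^2 * x^2 = n)
     \<longleftrightarrow> (\<exists>a b c d :: int.
            a > 0 \<and> b > 0 \<and> c > 0 \<and> d > 0 \<and>
            a + d = b + c \<and> a * b * c * d = n \<and>
            [a = b] (mod 2) \<and> [b = c] (mod 2) \<and> [c = d] (mod 2))"
  unfolding heron_factorization
proof
  assume "\<exists>x y z :: int. (x + y + z) * (x + y - z) * (x - y + z) * (x - y - z) = n"
  then obtain u v w :: int where sorted: "u \<ge> v" "v \<ge> w" "w \<ge> 0"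
    and prod: "(u + v + w) * (u + v - w) * (u - v + w) * (u - v - w) = n"
    by (metis heron_product_sorted_nonneg)
  have "[u + v + w = u + v - w] (mod 2)" "[u + v - w = u - v + w] (mod 2)"
    "[u - v + w = u - v - w] (mod 2)"
    unfolding cong_def by presburger+
  moreover have "(u + v + w) + (u - v - w) = (u + v - w) + (u - v + w)"
    by simp
  ultimately show "\<exists>a b c d :: int.
      a > 0 \<and> b > 0 \<and> c > 0 \<and> d > 0 \<and> a + d = b + c \<and> a * b * c * d = n \<and>
      [a = b] (mod 2) \<and> [b = c] (mod 2) \<and> [c = d] (mod 2)"
    using heron_factors_pos[OF sorted] prod assms by blast
next
  assume "\<exists>a b c d :: int.
      a > 0 \<and> b > 0 \<and> c > 0 \<and> d > 0 \<and> a + d = b + c \<and> a * b * c * d = n \<and>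
      [a = b] (mod 2) \<and> [b = c] (mod 2) \<and> [c = d] (mod 2)"
  then obtain a b c d :: int where sum: "a + d = b + c" and prod: "a * b * c * d = n"
    and parity: "[a = b] (mod 2)" "[b = c] (mod 2)" "[c = d] (mod 2)"
    by blast
  define x y z where "x = (a + d) div 2" and "y = (a - c) div 2" and "z = (a - b) div 2"
  have "2 * x = a + d" "2 * y = a - c" "2 * z = a - b"
    using parity unfolding x_def y_def z_def cong_def by presburger+
  then have "x + y + z = a" "x + y - z = b" "x - y + z = c" "x - y - z = d"
    using sum by linarith+
  then show "\<exists>x y z :: int. (x + y + z) * (x + y - z) * (x - y + z) * (x - y - z) = n"
    using prod by metis
qed

end
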